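(* For every integer $k>1$, the generalised ant with rule word $L^{2k}R$ has at least $k-1$ pairwise distinct harmonic highways, i.e. highways of period $32k+4$ and drift $(\pm2,\pm2)$.
   Context: A generalised ant with rule word $w=w_0w_1\cdots w_{|w|-1}\in\{L,R\}^+$ has state set $Q=\{\rightarrow,\uparrow,\leftarrow,\downarrow\}$ (the four unit vectors of $\mathbb{Z}^2$) and alphabet $A=\{0,1,\dots,|w|-1\}=\mathbb{Z}/|w|\mathbb{Z}$. A configuration is $(C,(i,j),d)\in A^{\mathbb{Z}^2}\times\mathbb{Z}^2\times Q$ (picture, ant position, ant direction). The transition $T_w(C,(i,j),d)=(C',(i',j'),d')$ is: $C'(i,j)=C(i,j)+1 \bmod |w|$ and $C'(k,l)=C(k,l)$ for $(k,l)\neq(i,j)$; $d'$ is $d$ rotated by $90^\circ$ clockwise if $w_{C(i,j)}=R$ and counterclockwise if $w_{C(i,j)}=L$; $(i',j')=(i,j)+d'$. A pattern is a map $P:S\to A$ with $S\subseteq\mathbb{Z}^2$ finite (its support); $T_w$ is applied to $(P,(i,j),d)$ by the same rule, provided $(i,j)\in S$. A highway of period $N$ and drift $(a,b)\in\mathbb{Z}^2$ of the ant $w$ is given by a pattern $P$ with support $S$, a position $(i,j)\in S$ and a direction $d$ such that $T_w$ can be applied $N$ times starting from $(P,(i,j),d)$ (the ant stays in $S$ before each application), the resulting pattern $T_w^N(P)$ has the ant at position $(i,j)+(a,b)$ with direction $d$, and for all $(x,y)\in S$: $P(x,y)=T_w^N(P)(x+a,y+b)$ if $(x+a,y+b)\in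 S$, and $P(x,y)=0$ otherwise. The trace of the ant is the sequence of symbols it reads along its evolution; a highway yields a periodic trace. Highways obtained from one another by rotation, translation, or by choosing another pattern along the same periodic evolution are regarded as the same highway; highways are distinct if their periodic traces differ (e.g. one contains a factor that the other does not). *)

theory Defs
  imports Complex_Main "HOL-Library.Product_Plus"
begin

datatype turn = L | R

datatype dir = East | North | West | South

fun unit_vec :: "dir \<Rightarrow> int \<times> int" where
  "unit_vec East = (1, 0)"
| "unit_vec North = (0, 1)"
| "unit_vec West = (-1, 0)"
| "unit_vec South = (0, -1)"

fun rot_ccw :: "dir \<Rightarrow> dir" where
  "rot_ccw East = North"
| "rot_ccw North = West"
| "rot_ccw West = South"
| "rot_ccw South = East"

fun rot_cw :: "dir \<Rightarrow> dir" where
  "rot_cw East = South"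
| "rot_cw South = West"
| "rot_cw West = North"
| "rot_cw North = East"

fun rotate_dir :: "turn \<Rightarrow> dir \<Rightarrow> dir" where
  "rotate_dir L d = rot_ccw d"
| "rotate_dir R d = rot_cw d"

text \<open>A pattern is a partial map from the plane to the alphabet \<open>{0..<length w}\<close> whose support is
  its \<^const>\<open>dom\<close>. A configuration is the special case \<open>dom P = UNIV\<close>, so one transition
  function serves for both. Finiteness of the support and the range condition are imposed in
  \<open>pattern\<close>.\<close>

type_synonym ant_state = "((int \<times> int) \<rightharpoonup> nat) \<times> (int \<times> int) \<times> dir"

definition pattern :: "turn list \<Rightarrow> ((int \<times> int) \<rightharpoonup> nat) \<Rightarrow> bool" where
  "pattern w P \<longleftrightarrow> finite (dom P) \<and> ran P \<subseteq> {..<length w}"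

text \<open>The result is \<^const>\<open>None\<close> if the ant stands outside the support.\<close>

fun ant_step :: "turn list \<Rightarrow> ant_state \<Rightarrow> ant_state option" where
  "ant_step w (P, p, d) =
     (case P p of
        None \<Rightarrow> None
      | Some c \<Rightarrow>
          (let d' = rotate_dir (w ! c) d
           in Some (P(p \<mapsto> (c + 1) mod length w), p + unit_vec d', d')))"

fun ant_steps :: "turn list \<Rightarrow> nat \<Rightarrow> ant_state \<Rightarrow> ant_state option" where
  "ant_steps w 0 s = Some s"
| "ant_steps w (Suc n) s = Option.bind (ant_step w s) (ant_steps w n)"

text \<open>The support of the resulting pattern \<open>P'\<close> is again \<open>dom P\<close>, but the final position \<open>p + v\<close>
  need not lie in it.\<close>

fun highway :: "turn list \<Rightarrow> nat \<Rightarrow> int \<times> int \<Rightarrow> ant_state \<Rightarrow> bool" where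
  "highway w N v (P, p, d) \<longleftrightarrow>
     pattern w P \<and> p \<in> dom P \<and>
     (\<exists>P'. ant_steps w N (P, p, d) = Some (P', p + v, d) \<and>
           (\<forall>x \<in> dom P. P x = (if x + v \<in> dom P then P' (x + v) else Some 0)))"

text \<open>The symbol read at time \<open>n\<close>, i.e. the one under the ant after \<open>n\<close> steps.\<close>

definition ant_trace :: "turn list \<Rightarrow> ant_state \<Rightarrow> nat \<Rightarrow> nat option" where
  "ant_trace w s n =
     (case ant_steps w n s of None \<Rightarrow> None | Some (P, p, d) \<Rightarrow> P p)"

text \<open>The periodic trace of a highway repeats forever the \<open>N\<close> symbols read during one period; all
  of them are \<^const>\<open>Some\<close> values, since the ant stays in the support for \<open>N\<close> steps.\<close>

definition highway_trace :: "turn list \<Rightarrow> nat \<Rightarrow> ant_state \<Rightarrow> nat \<Rightarrow> nat option" where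
  "highway_trace w N s n = ant_trace w s (n mod N)"

text \<open>Rotating or translating a highway preserves its trace, whereas starting at another moment of
  the same evolution shifts it. Hence periodic traces are compared up to a shift.\<close>

definition same_highway :: "turn list \<Rightarrow> nat \<Rightarrow> ant_state \<Rightarrow> ant_state \<Rightarrow> bool" where
  "same_highway w N s s' \<longleftrightarrow>
     (\<exists>m. \<forall>n. highway_trace w N s' n = highway_trace w N s (n + m))"

definition harmonic_word :: "nat \<Rightarrow> turn list" where
  "harmonic_word k = replicate (2 * k) L @ [R]"

definition harmonic_highway :: "nat \<Rightarrow> ant_state \<Rightarrow> bool" where
  "harmonic_highway k s \<longleftrightarrow>
     (\<exists>v \<in> {2, -2} \<times> {2, -2}. highway (harmonic_word k) (32 * k + 4) v s)"

end

theory Submission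
  imports Defs
begin

text \<open>
  Put \<open>n = 2k\<close>. Between two \<open>R\<close>-turns the ant circles a \<open>2 \<times> 2\<close> block, adding the same number to
  its four cells. For \<open>0 < a < n\<close> there is a local configuration \<open>S\<^sub>a\<close>, with nonzero symbols only in
  the four cells \<open>a - 1\<close>, \<open>a\<close>, \<open>a + 1\<close>, \<open>a\<close> of one block, such that three series of loops around
  three blocks turn it into \<open>S\<close> with parameter \<open>n - a\<close>, translated by \<open>(1, 1)\<close>, after
  \<open>12 n - 8 a + 2\<close> steps. Two such half periods give a highway of period \<open>16 n + 4\<close> and drift
  \<open>(2, 2)\<close>. The symbols that follow a symbol \<open>n\<close> in its trace are \<open>0\<close>, \<open>n\<close>, \<open>a\<close>, \<open>a + 1\<close>, \<open>n - a\<close>,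
  \<open>n - a + 1\<close>, and this set determines \<open>a\<close> when \<open>0 < a < k\<close>.
\<close>

section \<open>Runs with a prescribed trace\<close>

fun ant_run :: "turn list \<Rightarrow> ant_state \<Rightarrow> nat list \<Rightarrow> ant_state \<Rightarrow> bool" where
  "ant_run w s [] s' \<longleftrightarrow> s' = s"
| "ant_run w (P, p, d) (c # cs) s' \<longleftrightarrow> P p = Some c \<and>
     (let d' = rotate_dir (w ! c) d
      in ant_run w (P(p \<mapsto> (c + 1) mod length w), p + unit_vec d', d') cs s')"

lemma ant_run_append:
  "ant_run w s cs s' \<Longrightarrow> ant_run w s' ds s'' \<Longrightarrow> ant_run w s (cs @ ds) s''"
  by (induction w s cs s' rule: ant_run.induct) (auto simp: Let_def)

lemma ant_steps_if_ant_run: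
  "ant_run w s cs s' \<Longrightarrow> ant_steps w (length cs) s = Some s'"
  by (induction w s cs s' rule: ant_run.induct) (auto simp: Let_def)

text \<open>Together with \<open>ant_steps_if_ant_run\<close> this lets a single symbolic execution
  supply both the final state, needed for the highway, and the trace, needed to tell highways
  apart.\<close>

lemma ant_trace_if_ant_run:
  "ant_run w s cs s' \<Longrightarrow> i < length cs \<Longrightarrow> ant_trace w s i = Some (cs ! i)"
proof (induction w s cs s' arbitrary: i rule: ant_run.induct)
  case (2 w P p d c cs s')
  then show ?case
    by (cases i) (auto simp: ant_trace_def Let_def)
qed auto

lemma highway_trace_if_ant_run:
  assumes "ant_run w s cs s'" "cs \<noteq> []"
  shows "highway_trace w (length cs) s i = Some (cs ! (i mod length cs))"
  using assms by (simp add: highway_trace_def ant_trace_if_ant_run)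

section \<open>Loops around a block\<close>

abbreviation loop_word :: "nat \<Rightarrow> turn list" where
  "loop_word n \<equiv> replicate n L @ [R]"

lemma loop_word_nth: "c < n \<Longrightarrow> loop_word n ! c = L" "loop_word n ! n = R"
  by (simp_all add: nth_append)

text \<open>Below \<open>n\<close> the increment never wraps modulo \<open>n + 1\<close>. The target
  cell has its own name \<open>p'\<close>, so that the fourth step of a loop can land on
  \<open>p\<close> itself and not on a nested sum.\<close>

lemma ant_run_Cons_L:
  assumes "c < n" "P p = Some c" "p' = p + unit_vec (rot_ccw d)"
    "ant_run (loop_word n) (P(p \<mapsto> c + 1), p', rot_ccw d) cs s'"
  shows "ant_run (loop_word n) (P, p, d) (c # cs) s'"
  using assms by (simp add: Let_def loop_word_nth)

definition loop_trace :: "nat \<Rightarrow> nat \<Rightarrow> nat \<Rightarrow> nat \<Rightarrow> nat \<Rightarrow> nat list" where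
  "loop_trace m c0 c1 c2 c3 = concat (map (\<lambda>i. [c0 + i, c1 + i, c2 + i, c3 + i]) [0..<m])"

lemma length_loop_trace: "length (loop_trace m c0 c1 c2 c3) = 4 * m"
  by (induction m) (auto simp: loop_trace_def)

lemma set_loop_trace:
  assumes "c0 + m \<le> n" "c1 + m \<le> n" "c2 + m \<le> n" "c3 + m \<le> n"
  shows "set (loop_trace m c0 c1 c2 c3) \<subseteq> {..<n}"
  using assms by (auto simp: loop_trace_def)

lemma hd_loop_trace: "m > 0 \<Longrightarrow> hd (loop_trace m c0 c1 c2 c3) = c0"
  by (induction m) (auto simp: loop_trace_def hd_append)

lemma loop_trace_eq_Nil_iff: "loop_trace m c0 c1 c2 c3 = [] \<longleftrightarrow> m = 0"
  by (auto simp: loop_trace_def)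

text \<open>Four left turns lead back to the same cell and direction. The bounds keep every symbol
  read below \<open>n\<close>, so no right turn interrupts the loops.\<close>

lemma ant_run_loops:
  assumes q: "q1 = p + unit_vec (rot_ccw d)" "q2 = q1 + unit_vec (rot_ccw (rot_ccw d))"
    "q3 = q2 + unit_vec (rot_ccw (rot_ccw (rot_ccw d)))"
  assumes C: "C p = Some c0" "C q1 = Some c1" "C q2 = Some c2" "C q3 = Some c3"
  assumes "c0 + m \<le> n" "c1 + m \<le> n" "c2 + m \<le> n" "c3 + m \<le> n"
  shows "ant_run (loop_word n) (C, p, d) (loop_trace m c0 c1 c2 c3)
    (C(p \<mapsto> c0 + m, q1 \<mapsto> c1 + m, q2 \<mapsto> c2 + m, q3 \<mapsto> c3 + m), p, d)"
  using assms(8-)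
proof (induction m)
  case 0
  with C show ?case
    by (auto simp: loop_trace_def fun_eq_iff)
next
  case (Suc m)
  \<comment> \<open>The four cells are distinct, so each is updated once per loop, and the fourth
    step closes the loop.\<close>
  have ne: "p \<noteq> q1" "p \<noteq> q2" "p \<noteq> q3" "q1 \<noteq> q2" "q1 \<noteq> q3" "q2 \<noteq> q3"
    and closed: "p = q3 + unit_vec (rot_ccw (rot_ccw (rot_ccw (rot_ccw d))))" "rot_ccw (rot_ccw (rot_ccw (rot_ccw d))) = d"
    unfolding q by (cases d; cases p; simp)+
  have split: "loop_trace (Suc m) c0 c1 c2 c3 =
      loop_trace m c0 c1 c2 c3 @ [c0 + m, c1 + m, c2 + m, c3 + m]"
    by (simp add: loop_trace_def)
  show ?case
    unfolding split
  proof (rule ant_run_append[OF Suc.IH])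
    let ?C0 = "C(p \<mapsto> c0 + m, q1 \<mapsto> c1 + m, q2 \<mapsto> c2 + m, q3 \<mapsto> c3 + m)"
    have "C(p \<mapsto> c0 + Suc m, q1 \<mapsto> c1 + Suc m, q2 \<mapsto> c2 + Suc m, q3 \<mapsto> c3 + Suc m) =
      ?C0(p \<mapsto> c0 + m + 1, q1 \<mapsto> c1 + m + 1, q2 \<mapsto> c2 + m + 1, q3 \<mapsto> c3 + m + 1)"
      using ne by (auto simp: fun_eq_iff)
    moreover have "ant_run (loop_word n) (?C0, p, d) [c0 + m, c1 + m, c2 + m, c3 + m]
      (?C0(p \<mapsto> c0 + m + 1, q1 \<mapsto> c1 + m + 1, q2 \<mapsto> c2 + m + 1, q3 \<mapsto> c3 + m + 1), p, d)"
      by (rule ant_run_Cons_L[OF _ _ q(1) ant_run_Cons_L[OF _ _ q(2)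
            ant_run_Cons_L[OF _ _ q(3) ant_run_Cons_L[OF _ _ closed(1)]]]])
        (use Suc.prems ne ne[symmetric] closed(2) in simp_all)
    ultimately show "ant_run (loop_word n) (?C0, p, d) [c0 + m, c1 + m, c2 + m, c3 + m]
      (C(p \<mapsto> c0 + Suc m, q1 \<mapsto> c1 + Suc m, q2 \<mapsto> c2 + Suc m, q3 \<mapsto> c3 + Suc m), p, d)"
      by simp
  qed (use Suc.prems in simp_all)
qed

section \<open>Half a period\<close>

definition half_trace :: "nat \<Rightarrow> nat \<Rightarrow> nat list" where
  "half_trace n a = loop_trace n 0 0 0 0 @ [n] @ loop_trace (n - a) a 0 0 0 @ [n] @
     loop_trace (n - a - 1) (a + 1) (a - 1) a 0 @ [n, n, n - a, n]"

text \<open>A series of loops stops when the cell where it began holds \<open>n\<close>; this gives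
  the lengths \<open>n\<close>, \<open>n - a\<close> and \<open>n - a - 1\<close>. The turns right,
  right, left, right then lead to \<open>(x + 1, y + 1)\<close>. Around that cell the hypotheses
  hold again with \<open>n - a\<close> for \<open>a\<close>, once the five new cells hold 0.\<close>

lemma ant_run_half:
  assumes a: "0 < a" "a < n"
  assumes C: "C (x, y) = Some 0" "C (x, y + 1) = Some 0" "C (x - 1, y + 1) = Some 0"
    "C (x - 1, y) = Some 0" "C (x + 1, y - 1) = Some 0" "C (x + 1, y) = Some 0"
    "C (x, y - 1) = Some a" "C (x - 1, y - 1) = Some (a + 1)"
    "C (x - 1, y - 2) = Some (a - 1)" "C (x, y - 2) = Some a"
  shows "ant_run (loop_word n) (C, (x, y), East) (half_trace n a)
    (C((x, y) \<mapsto> n - a + 1, (x, y + 1) \<mapsto> 0, (x - 1, y + 1) \<mapsto> n, (x - 1, y) \<mapsto> 0,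
       (x, y - 1) \<mapsto> n - a - 1, (x + 1, y - 1) \<mapsto> n - a, (x + 1, y) \<mapsto> n - a,
       (x - 1, y - 1) \<mapsto> 0, (x - 1, y - 2) \<mapsto> n - 2, (x, y - 2) \<mapsto> n - 1),
     (x + 1, y + 1), East)"
proof -
  let ?w = "loop_word n"
  \<comment> \<open>\<open>C1\<close>, \<open>C3\<close>, \<open>C5\<close> are the pictures after
    the three series, \<open>C2\<close> and \<open>C4\<close> those after the right turns between
    them, and \<open>C6\<close> the final one. Each of these two turns resets a cell to 0 that the
    next block shares with the previous one.\<close>
  define C1 where "C1 = C((x, y) \<mapsto> n, (x, y + 1) \<mapsto> n, (x - 1, y + 1) \<mapsto> n, (x - 1, y) \<mapsto> n)"
  define C2 where "C2 = C1((x, y) \<mapsto> 0)"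
  define C3 where
    "C3 = C2((x, y - 1) \<mapsto> n, (x + 1, y - 1) \<mapsto> n - a, (x + 1, y) \<mapsto> n - a, (x, y) \<mapsto> n - a)"
  define C4 where "C4 = C3((x, y - 1) \<mapsto> 0)"
  define C5 where "C5 = C4((x - 1, y - 1) \<mapsto> n, (x - 1, y - 2) \<mapsto> n - 2,
    (x, y - 2) \<mapsto> n - 1, (x, y - 1) \<mapsto> n - a - 1)"
  define C6 where "C6 = C5((x - 1, y - 1) \<mapsto> 0, (x - 1, y) \<mapsto> 0, (x, y) \<mapsto> n - a + 1, (x, y + 1) \<mapsto> 0)"
  have 1: "ant_run ?w (C, (x, y), East) (loop_trace n 0 0 0 0) (C1, (x, y), East)"
    unfolding C1_def
    using ant_run_loops[where C = C and p = "(x, y)" and d = East and m = n and n = n] C by simp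
  have 2: "ant_run ?w (C1, (x, y), East) [n] (C2, (x, y - 1), South)"
    by (simp add: C1_def C2_def loop_word_nth)
  have 3: "ant_run ?w (C2, (x, y - 1), South) (loop_trace (n - a) a 0 0 0) (C3, (x, y - 1), South)"
    unfolding C3_def
    using ant_run_loops[where C = C2 and p = "(x, y - 1)" and d = South and m = "n - a" and n = n
        and ?c0.0 = a and ?c1.0 = 0 and ?c2.0 = 0 and ?c3.0 = 0] C a
    by (simp add: C1_def C2_def)
  have 4: "ant_run ?w (C3, (x, y - 1), South) [n] (C4, (x - 1, y - 1), West)"
    by (simp add: C3_def C4_def loop_word_nth)
  have 5: "ant_run ?w (C4, (x - 1, y - 1), West) (loop_trace (n - a - 1) (a + 1) (a - 1) a 0)
    (C5, (x - 1, y - 1), West)"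
    unfolding C5_def
    using ant_run_loops[where C = C4 and p = "(x - 1, y - 1)" and d = West and m = "n - a - 1" and n = n
        and ?c0.0 = "a + 1" and ?c1.0 = "a - 1" and ?c2.0 = a and ?c3.0 = 0] C a
    by (simp add: C1_def C2_def C3_def C4_def)
  have 6: "ant_run ?w (C5, (x - 1, y - 1), West) [n, n, n - a, n] (C6, (x + 1, y + 1), East)"
    using a by (simp add: C1_def C2_def C3_def C4_def C5_def C6_def loop_word_nth zero_prod_def)
  have "C6 = C((x, y) \<mapsto> n - a + 1, (x, y + 1) \<mapsto> 0, (x - 1, y + 1) \<mapsto> n, (x - 1, y) \<mapsto> 0,
       (x, y - 1) \<mapsto> n - a - 1, (x + 1, y - 1) \<mapsto> n - a, (x + 1, y) \<mapsto> n - a,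
       (x - 1, y - 1) \<mapsto> 0, (x - 1, y - 2) \<mapsto> n - 2, (x, y - 2) \<mapsto> n - 1)"
    (is "_ = ?C'")
  proof
    fix z
    let ?D = "{(x, y), (x, y + 1), (x - 1, y + 1), (x - 1, y), (x, y - 1), (x + 1, y - 1),
      (x + 1, y), (x - 1, y - 1), (x - 1, y - 2), (x, y - 2)}"
    consider "z \<in> ?D" | "z \<notin> ?D"
      by blast
    then show "C6 z = ?C' z"
    proof cases
      case 1
      then show ?thesis
        unfolding C1_def C2_def C3_def C4_def C5_def C6_def by (elim insertE emptyE) simp_all
    next
      case 2
      then show ?thesis
        by (simp add: C1_def C2_def C3_def C4_def C5_def C6_def)
    qed
  qed
  with ant_run_append[OF 1 ant_run_append[OF 2 ant_run_append[OF 3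
        ant_run_append[OF 4 ant_run_append[OF 5 6]]]]]
  show ?thesis
    by (simp add: half_trace_def)
qed

section \<open>The highways\<close>

definition start_pattern :: "nat \<Rightarrow> (int \<times> int) \<rightharpoonup> nat" where
  "start_pattern a = map_of
    [((-1, -2), a - 1), ((0, -2), a), ((-1, -1), a + 1), ((0, -1), a),
     ((1, -1), 0), ((-1, 0), 0), ((0, 0), 0), ((1, 0), 0), ((2, 0), 0),
     ((-1, 1), 0), ((0, 1), 0), ((1, 1), 0), ((2, 1), 0), ((0, 2), 0), ((1, 2), 0)]"

definition start_state :: "nat \<Rightarrow> ant_state" where
  "start_state a = (start_pattern a, (0, 0), East)"

definition full_trace :: "nat \<Rightarrow> nat \<Rightarrow> nat list" where
  "full_trace n a = half_trace n a @ half_trace n (n - a)"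

lemma length_full_trace:
  assumes "0 < a" "a < n"
  shows "length (full_trace n a) = 16 * n + 4"
  using assms by (simp add: full_trace_def half_trace_def length_loop_trace)

text \<open>The five values listed are those at the cells \<open>x + (2, 2)\<close> of the support
  with \<open>x\<close> in the support, which are all that the highway condition inspects.\<close>

lemma ant_run_full_trace:
  assumes a: "0 < a" "a < n"
  obtains P' where "ant_run (loop_word n) (start_state a) (full_trace n a) (P', (2, 2), East)"
    "P' (1, 0) = Some (a - 1)" "P' (2, 0) = Some a" "P' (1, 1) = Some (a + 1)"
    "P' (2, 1) = Some a" "P' (1, 2) = Some 0"
proof -
  let ?P = "start_pattern a"
  define b where "b = n - a"
  have b: "0 < b" "b < n" and nb: "n - b = a"
    using a by (auto simp: b_def)
  define P1 where "P1 = ?P((0, 0) \<mapsto> b + 1, (0, 1) \<mapsto> 0, (-1, 1) \<mapsto> n, (-1, 0) \<mapsto> 0,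
    (0, -1) \<mapsto> b - 1, (1, -1) \<mapsto> b, (1, 0) \<mapsto> b, (-1, -1) \<mapsto> 0, (-1, -2) \<mapsto> n - 2, (0, -2) \<mapsto> n - 1)"
  define P2 where "P2 = P1((1, 1) \<mapsto> a + 1, (1, 2) \<mapsto> 0, (0, 2) \<mapsto> n, (0, 1) \<mapsto> 0,
    (1, 0) \<mapsto> a - 1, (2, 0) \<mapsto> a, (2, 1) \<mapsto> a, (0, 0) \<mapsto> 0, (0, -1) \<mapsto> n - 2, (1, -1) \<mapsto> n - 1)"
  have 1: "ant_run (loop_word n) (?P, (0, 0), East) (half_trace n a) (P1, (1, 1), East)"
    using ant_run_half[OF a, where C = ?P and x = 0 and y = 0]
    by (simp add: start_pattern_def P1_def b_def)
  have 2: "ant_run (loop_word n) (P1, (1, 1), East) (half_trace n b) (P2, (2, 2), East)"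
    using ant_run_half[OF b, where C = P1 and x = 1 and y = 1]
    by (simp add: start_pattern_def P1_def P2_def nb)
  show thesis
  proof
    show "ant_run (loop_word n) (start_state a) (full_trace n a) (P2, (2, 2), East)"
      using ant_run_append[OF 1 2] by (simp add: start_state_def full_trace_def b_def)
  qed (simp_all add: P2_def)
qed

lemma highway_start_state:
  assumes a: "0 < a" "a < n"
  shows "highway (loop_word n) (16 * n + 4) (2, 2) (start_state a)"
proof -
  obtain P' where run: "ant_run (loop_word n) (start_state a) (full_trace n a) (P', (2, 2), East)"
    and P': "P' (1, 0) = Some (a - 1)" "P' (2, 0) = Some a" "P' (1, 1) = Some (a + 1)"
      "P' (2, 1) = Some a" "P' (1, 2) = Some 0"
    using ant_run_full_trace[OF a] .
  \<comment> \<open>The support is the union of the ten cells of \<open>ant_run_half\<close> around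
    \<open>(0, 0)\<close> and the ten around \<open>(1, 1)\<close>.\<close>
  have dom: "dom (start_pattern a) = {(-1, -2), (0, -2), (-1, -1), (0, -1), (1, -1), (-1, 0), (0, 0),
      (1, 0), (2, 0), (-1, 1), (0, 1), (1, 1), (2, 1), (0, 2), (1, 2)}"
    by (simp add: start_pattern_def dom_map_of_conv_image_fst)
  have "ran (start_pattern a) \<subseteq> {..<n + 1}"
  proof
    fix c
    assume "c \<in> ran (start_pattern a)"
    then obtain x where "start_pattern a x = Some c"
      by (auto simp: ran_def)
    from map_of_SomeD[OF this[unfolded start_pattern_def]] a show "c \<in> {..<n + 1}"
      by auto
  qed
  then have "pattern (loop_word n) (start_pattern a)"
    by (simp add: pattern_def dom)
  moreover have "ant_steps (loop_word n) (16 * n + 4) (start_state a) = Some (P', (2, 2), East)"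
    using ant_steps_if_ant_run[OF run] by (simp add: length_full_trace a)
  moreover have "\<forall>x\<in>dom (start_pattern a). start_pattern a x =
      (if x + (2, 2) \<in> dom (start_pattern a) then P' (x + (2, 2)) else Some 0)"
    unfolding dom by (simp add: P' start_pattern_def)
  ultimately show ?thesis
    by (simp add: start_state_def dom)
qed

section \<open>Distinguishing the traces\<close>

definition successors :: "nat \<Rightarrow> nat \<Rightarrow> nat set" where
  "successors n a = {0, n, a, a + 1, n - a, n - a + 1}"

lemma successively_if_antecedent_notin:
  "n \<notin> set xs \<Longrightarrow> successively (\<lambda>x y. x = n \<longrightarrow> y \<in> S) xs"
  by (induction xs rule: induct_list012) auto

text \<open>Symbols read in loops stay below \<open>n\<close>, so only the explicit entries
  \<open>n\<close> matter. The appended 0 is the first symbol of the following half period.\<close>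

lemma successively_half_trace:
  assumes a: "0 < a" "a < n" and S: "successors n a \<subseteq> S"
  shows "successively (\<lambda>x y. x = n \<longrightarrow> y \<in> S) (half_trace n a @ [0])"
proof -
  have loop: "successively (\<lambda>x y. x = n \<longrightarrow> y \<in> S) (loop_trace m c0 c1 c2 c3)"
    "m > 0 \<Longrightarrow> last (loop_trace m c0 c1 c2 c3) \<noteq> n"
    if "c0 + m \<le> n" "c1 + m \<le> n" "c2 + m \<le> n" "c3 + m \<le> n" for m c0 c1 c2 c3
  proof -
    note sub = set_loop_trace[OF that]
    then show "successively (\<lambda>x y. x = n \<longrightarrow> y \<in> S) (loop_trace m c0 c1 c2 c3)"
      by (intro successively_if_antecedent_notin) auto
    show "last (loop_trace m c0 c1 c2 c3) \<noteq> n" if "m > 0"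
    proof -
      have "last (loop_trace m c0 c1 c2 c3) \<in> set (loop_trace m c0 c1 c2 c3)"
        using that by (simp add: loop_trace_eq_Nil_iff)
      with sub show ?thesis
        by auto
    qed
  qed
  \<comment> \<open>If the third series is empty, the symbol after the second right turn is
    \<open>n\<close>, which then equals \<open>a + 1\<close>.\<close>
  have "a + 1 = n" if "\<not> 0 < n - a - 1"
    using that a by simp
  then show ?thesis
    using a S
    by (cases "0 < n - a - 1")
      (simp_all add: half_trace_def successively_append_iff successively_Cons loop hd_loop_trace
        loop_trace_eq_Nil_iff hd_append successors_def)
qed

lemma highway_trace_start_state:
  assumes "0 < a" "a < n"
  shows "highway_trace (loop_word n) (16 * n + 4) (start_state a) i =
    Some (full_trace n a ! (i mod (16 * n + 4)))"
proof -
  obtain P' where "ant_run (loop_word n) (start_state a) (full_trace n a) (P', (2, 2), East)"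
    using ant_run_full_trace[OF assms] .
  from highway_trace_if_ant_run[OF this] length_full_trace[OF assms] show ?thesis
    by fastforce
qed

lemma full_trace_successor:
  assumes a: "0 < a" "a < n"
    and tr: "highway_trace (loop_word n) (16 * n + 4) (start_state a) i = Some n"
      "highway_trace (loop_word n) (16 * n + 4) (start_state a) (Suc i) = Some c"
  shows "c \<in> successors n a"
proof -
  let ?P = "\<lambda>x y. x = n \<longrightarrow> y \<in> successors n a" and ?xs = "full_trace n a"
  define N where "N = 16 * n + 4"
  define j where "j = i mod N"
  \<comment> \<open>The set is symmetric under exchanging \<open>a\<close> and \<open>n - a\<close>,
    so it serves both halves.\<close>
  have b: "0 < n - a" "n - a < n" "successors n (n - a) \<subseteq> successors n a"
    using a by (auto simp: successors_def)
  have hd0: "half_trace n c \<noteq> [] \<and> hd (half_trace n c) = 0" for c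
    using a by (simp add: half_trace_def hd_append loop_trace_eq_Nil_iff hd_loop_trace)
  have "successively ?P (half_trace n a @ [0])" "successively ?P (half_trace n (n - a) @ [0])"
    using a b by (blast intro: successively_half_trace)+
  then have succ: "successively ?P (?xs @ [0])"
    using hd0 by (auto simp: full_trace_def successively_append_iff)
  have len: "length ?xs = N"
    using length_full_trace[OF a] by (simp add: N_def)
  have j: "j < N" and nth: "?xs ! j = n" "?xs ! (Suc i mod N) = c"
    using tr by (auto simp: highway_trace_start_state[OF a] j_def N_def)
  \<comment> \<open>The appended 0 thus stands for the symbol read after wrapping around at the end
    of the period.\<close>
  have "?xs ! 0 = 0"
    using hd0 by (simp add: full_trace_def nth_append flip: hd_conv_nth)
  moreover have "Suc i mod N = (if Suc j = N then 0 else Suc j)"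
    by (simp add: j_def mod_Suc)
  ultimately have "(?xs @ [0]) ! Suc j = c"
    using nth j len by (auto simp: nth_append split: if_splits)
  moreover have "(?xs @ [0]) ! j = n"
    using nth j len by (simp add: nth_append)
  ultimately show ?thesis
    using succ j len by (auto simp: successively_conv_nth)
qed

text \<open>The closing entries \<open>n, n, n - d, n\<close> of a half trace put
  \<open>n - d\<close> right after an \<open>n\<close>; the two halves have \<open>d = a\<close> and
  \<open>d = n - a\<close>.\<close>

lemma full_trace_has_successor:
  assumes a: "0 < a" "a < n" and c: "c = a \<or> c = n - a"
  obtains i where
    "highway_trace (loop_word n) (16 * n + 4) (start_state a) i = Some n"
    "highway_trace (loop_word n) (16 * n + 4) (start_state a) (Suc i) = Some c"
proof -
  have *: "\<exists>ys zs. half_trace n d = ys @ n # (n - d) # zs" for d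
    unfolding half_trace_def by (metis append.assoc append_Cons append_Nil)
  have "\<exists>ys zs. full_trace n a = ys @ n # c # zs"
    using c
  proof
    assume "c = a"
    with *[of "n - a"] a show ?thesis
      by (metis full_trace_def append.assoc diff_diff_cancel less_imp_le_nat)
  next
    assume "c = n - a"
    with *[of a] show ?thesis
      by (metis full_trace_def append.assoc append_Cons)
  qed
  then obtain ys zs where eq: "full_trace n a = ys @ n # c # zs"
    by blast
  then have "Suc (length ys) < 16 * n + 4"
    using length_full_trace[OF a] by simp
  with that[of "length ys"] show thesis
    by (simp add: highway_trace_start_state[OF a] eq nth_append)
qed

text \<open>A shift preserves pairs of neighbouring symbols, so what follows \<open>2 * k\<close> in
  one trace also follows it in the other.\<close>

lemma same_highway_start_state_imp_eq:
  assumes a: "0 < a" "a < k" and a': "0 < a'" "a' < k"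
    and same: "same_highway (loop_word (2 * k)) (32 * k + 4) (start_state a) (start_state a')"
  shows "a = a'"
proof -
  let ?tr = "highway_trace (loop_word (2 * k)) (32 * k + 4)"
  obtain m where m: "?tr (start_state a') i = ?tr (start_state a) (i + m)" for i
    using same by (auto simp: same_highway_def)
  have "c \<in> successors (2 * k) a" if c: "c = a' \<or> c = 2 * k - a'" for c
  proof -
    obtain i where "?tr (start_state a') i = Some (2 * k)" "?tr (start_state a') (Suc i) = Some c"
      using full_trace_has_successor[OF _ _ c] a' by auto
    with full_trace_successor[of a "2 * k" "i + m" c] a show ?thesis
      by (simp add: m)
  qed
  \<comment> \<open>As \<open>a'\<close> is below \<open>k\<close>, the first membership leaves
    \<open>a\<close> and \<open>a + 1\<close>; as \<open>2 * k - a'\<close> exceeds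
    \<open>k\<close>, the second leaves only \<open>a\<close> and \<open>a - 1\<close> for
    \<open>a'\<close>.\<close>
  from this[of a'] this[of "2 * k - a'"] show ?thesis
    using a a' by (auto simp: successors_def)
qed

theorem mainTheorem3:
  fixes k :: nat
  assumes "k > 1"
  shows "\<exists>H. finite H \<and> card H \<ge> k - 1 \<and>
           (\<forall>s \<in> H. harmonic_highway k s) \<and>
           pairwise (\<lambda>s s'. \<not> same_highway (harmonic_word k) (32 * k + 4) s s') H"
proof -
  define H where "H = start_state ` {0<..<k}"
  have refl: "same_highway w N s s" for w N s
    by (auto simp: same_highway_def intro: exI[of _ 0])
  \<comment> \<open>Equal states have the same highway by reflexivity, so distinctness of the
    highways already gives injectivity.\<close>
  have "inj_on start_state {0<..<k}"
    by (rule inj_onI) (metis greaterThanLessThan_iff refl same_highway_start_state_imp_eq)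
  then have "card H = k - 1"
    by (simp add: H_def card_image)
  moreover have "harmonic_highway k s" if s_in: "s \<in> H" for s
  proof -
    obtain a where "0 < a" "a < k" and s: "s = start_state a"
      using s_in by (auto simp: H_def)
    with highway_start_state[of a "2 * k"] show ?thesis
      by (auto simp: harmonic_highway_def harmonic_word_def s intro!: bexI[of _ "(2, 2)"])
  qed
  moreover have "pairwise (\<lambda>s s'. \<not> same_highway (harmonic_word k) (32 * k + 4) s s') H"
    by (auto simp: pairwise_def H_def harmonic_word_def dest: same_highway_start_state_imp_eq)
  ultimately show ?thesis
    by (intro exI[of _ H]) (simp add: H_def)
qed

end
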